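(* A (not necessarily connected) graph $G$ admits a harmonic labeling $\ell$ if and only if $S_G=\emptyset$ and the collection $\mathcal{A}_{(G,\ell)}$ satisfies, for $A,B\in\mathcal{A}_{(G,\ell)}$: (ZP1) for every $k\in\mathbb{Z}$ there exists $C\in\mathcal{A}_{(G,\ell)}$ such that $av(C)=k$; (ZP2) $av(A)\neq av(B)$ if $A\neq B$; (ZP3) if $av(A)\in B$ then $av(B)\in A$.
   Context: Graphs are simple, of bounded degree, and every connected component has at least three vertices. $V_G$ is the vertex set of $G$, $v\sim w$ means that $v$ and $w$ are adjacent, $S_G$ is the set of leaves (vertices of degree one), and $N_G(v)=\{v\}\cup\{w: w\sim v\}$ is the closed neighborhood of $v$. An integer interval is a (finite or infinite) set of consecutive integers. A weak harmonic labeling of $G$ is a bijection $\ell$ from $V_G$ onto an integer interval with $\ell(v)=\frac{1}{\deg(v)}\sum_{w\sim v}\ell(w)$ for every $v\in V_G\setminus S_G$. A harmonic labeling of $G$ is a bijection $\ell:V_G\to\mathbb{Z}$ satisfying this equation for every $v\in V_G$; equivalently, a weak harmonic labeling onto $\mathbb{Z}$ of a graph with $S_G=\emptyset$. For a nonempty finite $A\subset\mathbb{Z}$, $av(A)=\frac{1}{|A|}\sum_{k\in A}k$. For a graph $G$ with a weak harmonic labeling $\ell$, $\mathcal{A}_{(G,\ell)}=\{A_v: v\in V_G\setminus S_G\}$, where $A_v=\{\ell(w): w\in N_G(v)\}$. *)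

theory Defs
  imports Complex_Main
begin

text \<open>Graphs may be infinite, so they are given by a vertex set and an adjacency predicate.\<close>

definition nbrs :: "('a \<Rightarrow> 'a \<Rightarrow> bool) \<Rightarrow> 'a \<Rightarrow> 'a set" where
  "nbrs adj v = {w. adj v w}"

definition closed_nbrs :: "('a \<Rightarrow> 'a \<Rightarrow> bool) \<Rightarrow> 'a \<Rightarrow> 'a set" where
  "closed_nbrs adj v = insert v (nbrs adj v)"

definition deg :: "('a \<Rightarrow> 'a \<Rightarrow> bool) \<Rightarrow> 'a \<Rightarrow> nat" where
  "deg adj v = card (nbrs adj v)"

definition leaves :: "'a set \<Rightarrow> ('a \<Rightarrow> 'a \<Rightarrow> bool) \<Rightarrow> 'a set" where
  "leaves V adj = {v \<in> V. deg adj v = 1}"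

definition component :: "('a \<Rightarrow> 'a \<Rightarrow> bool) \<Rightarrow> 'a \<Rightarrow> 'a set" where
  "component adj v = {w. adj\<^sup>*\<^sup>* v w}"

text \<open>
  Finiteness is treated explicitly in the last two conditions because \<^term>\<open>card\<close> is \<open>0\<close> on
  infinite sets.
\<close>

locale bounded_simple_graph =
  fixes V :: "'a set" and adj :: "'a \<Rightarrow> 'a \<Rightarrow> bool"
  assumes adj_closed: "adj v w \<Longrightarrow> v \<in> V \<and> w \<in> V"
    and adj_sym: "adj v w \<Longrightarrow> adj w v"
    and adj_irrefl: "\<not> adj v v"
    and bounded_degree: "\<exists>d. \<forall>v\<in>V. finite (nbrs adj v) \<and> deg adj v \<le> d"
    and component_size: "v \<in> V \<Longrightarrow> infinite (component adj v) \<or> card (component adj v) \<ge> 3"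

definition integer_interval :: "int set \<Rightarrow> bool" where
  "integer_interval I \<longleftrightarrow> (\<forall>a\<in>I. \<forall>b\<in>I. {a..b} \<subseteq> I)"

definition harmonic_at :: "('a \<Rightarrow> 'a \<Rightarrow> bool) \<Rightarrow> ('a \<Rightarrow> int) \<Rightarrow> 'a \<Rightarrow> bool" where
  "harmonic_at adj l v \<longleftrightarrow>
     real_of_int (l v) = 1 / real (deg adj v) * (\<Sum>w\<in>nbrs adj v. real_of_int (l w))"

definition weak_harmonic_labeling ::
  "'a set \<Rightarrow> ('a \<Rightarrow> 'a \<Rightarrow> bool) \<Rightarrow> ('a \<Rightarrow> int) \<Rightarrow> bool" where
  "weak_harmonic_labeling V adj l \<longleftrightarrow>
     (\<exists>I. integer_interval I \<and> bij_betw l V I) \<and>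
     (\<forall>v\<in>V - leaves V adj. harmonic_at adj l v)"

definition harmonic_labeling ::
  "'a set \<Rightarrow> ('a \<Rightarrow> 'a \<Rightarrow> bool) \<Rightarrow> ('a \<Rightarrow> int) \<Rightarrow> bool" where
  "harmonic_labeling V adj l \<longleftrightarrow>
     bij_betw l V (UNIV :: int set) \<and> (\<forall>v\<in>V. harmonic_at adj l v)"

definition av :: "int set \<Rightarrow> real" where
  "av A = 1 / real (card A) * (\<Sum>k\<in>A. real_of_int k)"

definition label_collection ::
  "'a set \<Rightarrow> ('a \<Rightarrow> 'a \<Rightarrow> bool) \<Rightarrow> ('a \<Rightarrow> int) \<Rightarrow> int set set" where
  "label_collection V adj l = (\<lambda>v. l ` closed_nbrs adj v) ` (V - leaves V adj)"

definition ZP1 :: "int set set \<Rightarrow> bool" where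
  "ZP1 \<A> \<longleftrightarrow> (\<forall>k::int. \<exists>C\<in>\<A>. av C = real_of_int k)"

definition ZP2 :: "int set set \<Rightarrow> bool" where
  "ZP2 \<A> \<longleftrightarrow> (\<forall>A\<in>\<A>. \<forall>B\<in>\<A>. A \<noteq> B \<longrightarrow> av A \<noteq> av B)"

definition ZP3 :: "int set set \<Rightarrow> bool" where
  "ZP3 \<A> \<longleftrightarrow> (\<forall>A\<in>\<A>. \<forall>B\<in>\<A>. av A \<in> real_of_int ` B \<longrightarrow> av B \<in> real_of_int ` A)"

end

theory Submission
  imports Defs
begin

text \<open>
  Everything rests on one identity: if \<open>l\<close> is harmonic at \<open>v\<close>, then appending \<open>v\<close> itself to its
  neighborhood does not change the mean of the labels, so \<open>av\<close> sends the set \<open>A\<^sub>v\<close> of labels on the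
  closed neighborhood of \<open>v\<close> back to \<open>l v\<close> (\<open>av_closed_nbrs_labels\<close>). Averages of members of the
  collection are therefore the labels themselves, and the three conditions become statements about
  \<open>l\<close>: (ZP1) says that every integer is a label, (ZP2) follows from the injectivity of \<open>l\<close>, and,
  since \<open>l v \<in> A\<^sub>w\<close> means that \<open>v\<close> lies in the closed neighborhood of \<open>w\<close>, (ZP3) is the symmetry of
  adjacency.

  A harmonic labeling admits no leaves, because a leaf would carry the same label as its only
  neighbor. Conversely, if there are no leaves, then a weak harmonic labeling is harmonic at every
  vertex, and (ZP1) makes it onto the integers.
\<close>

context bounded_simple_graph
begin

lemma finite_nbrs: "v \<in> V \<Longrightarrow> finite (nbrs adj v)"
  using bounded_degree by blast

lemma closed_nbrs_subset: "v \<in> V \<Longrightarrow> closed_nbrs adj v \<subseteq> V"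
  using adj_closed by (auto simp: closed_nbrs_def nbrs_def)

lemma closed_nbrs_sym: "v \<in> closed_nbrs adj w \<longleftrightarrow> w \<in> closed_nbrs adj v"
  using adj_sym by (auto simp: closed_nbrs_def nbrs_def)

text \<open>
  The \<open>d\<close> neighbors of \<open>v\<close> have label sum \<open>d * l v\<close>, so with \<open>v\<close> itself the sum is
  \<open>(d + 1) * l v\<close>, spread over \<open>d + 1\<close> distinct labels. At an isolated vertex the convention
  \<open>1 / 0 = 0\<close> turns harmonicity into \<open>l v = 0\<close>, and the same computation goes through.
\<close>

lemma av_closed_nbrs_labels:
  assumes v: "v \<in> V" and inj: "inj_on l V" and harm: "harmonic_at adj l v"
  shows "av (l ` closed_nbrs adj v) = real_of_int (l v)"
proof -
  let ?N = "nbrs adj v" and ?d = "real (deg adj v)"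
  have fin: "finite ?N" using v by (rule finite_nbrs)
  have notin: "v \<notin> ?N" using adj_irrefl by (simp add: nbrs_def)
  have inj': "inj_on l (closed_nbrs adj v)"
    using inj closed_nbrs_subset[OF v] by (rule inj_on_subset)
  have nbr_sum: "(\<Sum>w\<in>?N. real_of_int (l w)) = ?d * real_of_int (l v)"
  proof (cases "deg adj v = 0")
    case True
    then show ?thesis using fin by (simp add: deg_def)
  next
    case False
    then show ?thesis using harm by (simp add: harmonic_at_def)
  qed
  have "(\<Sum>k\<in>l ` closed_nbrs adj v. real_of_int k) = (\<Sum>w\<in>closed_nbrs adj v. real_of_int (l w))"
    using inj' by (simp add: sum.reindex)
  also have "\<dots> = (?d + 1) * real_of_int (l v)"
    using fin notin nbr_sum by (simp add: closed_nbrs_def algebra_simps)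
  finally have total: "(\<Sum>k\<in>l ` closed_nbrs adj v. real_of_int k) = (?d + 1) * real_of_int (l v)" .
  have card: "real (card (l ` closed_nbrs adj v)) = ?d + 1"
    using inj' fin notin by (simp add: card_image closed_nbrs_def deg_def)
  have "?d + 1 \<noteq> 0" by (simp add: add_nonneg_eq_0_iff)
  then show ?thesis by (simp add: av_def total card)
qed

lemma harmonic_imp_weak_harmonic:
  assumes "harmonic_labeling V adj l"
  shows "weak_harmonic_labeling V adj l"
  using assms unfolding harmonic_labeling_def weak_harmonic_labeling_def integer_interval_def
  by blast

lemma harmonic_imp_no_leaves:
  assumes "harmonic_labeling V adj l"
  shows "leaves V adj = {}"
proof (rule ccontr)
  assume "leaves V adj \<noteq> {}"
  then obtain v where v: "v \<in> V" and deg: "deg adj v = 1" by (auto simp: leaves_def)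
  from deg obtain w where N: "nbrs adj v = {w}" by (auto simp: deg_def card_1_singleton_iff)
  then have vw: "adj v w" by (auto simp: nbrs_def)
  have "l v = l w"
    using assms v deg N by (auto simp: harmonic_labeling_def harmonic_at_def)
  moreover have "inj_on l V" using assms by (simp add: harmonic_labeling_def bij_betw_def)
  ultimately have "v = w" using v adj_closed[OF vw] by (auto dest: inj_onD)
  with vw show False using adj_irrefl by simp
qed

lemma harmonic_imp_ZP:
  assumes harm: "harmonic_labeling V adj l"
  shows "ZP1 (label_collection V adj l)"
    and "ZP2 (label_collection V adj l)"
    and "ZP3 (label_collection V adj l)"
proof -
  let ?A = "\<lambda>v. l ` closed_nbrs adj v"
  have inj: "inj_on l V" and surj: "l ` V = UNIV"
    using harm by (auto simp: harmonic_labeling_def bij_betw_def)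
  have coll: "label_collection V adj l = ?A ` V"
    using harmonic_imp_no_leaves[OF harm] by (simp add: label_collection_def)
  have av_A: "av (?A v) = real_of_int (l v)" if "v \<in> V" for v
    using that inj harm by (intro av_closed_nbrs_labels) (auto simp: harmonic_labeling_def)
  show "ZP1 (label_collection V adj l)"
    unfolding ZP1_def coll
  proof
    fix k :: int
    obtain v where "v \<in> V" "k = l v" using surj by blast
    then show "\<exists>C\<in>?A ` V. av C = real_of_int k" using av_A by auto
  qed
  show "ZP2 (label_collection V adj l)"
    unfolding ZP2_def coll using av_A inj by (auto dest: inj_onD)
  have mem: "av (?A v) \<in> real_of_int ` ?A w \<longleftrightarrow> v \<in> closed_nbrs adj w"
    if "v \<in> V" "w \<in> V" for v w
    using that inj_on_image_mem_iff[OF inj that(1) closed_nbrs_subset[OF that(2)]]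
    by (auto simp: av_A)
  show "ZP3 (label_collection V adj l)"
    unfolding ZP3_def coll using mem closed_nbrs_sym by blast
qed

text \<open>
  Without leaves every member of the collection is \<open>A\<^sub>v\<close> for a vertex \<open>v\<close> at which \<open>l\<close> is harmonic.
  A set with average \<open>k\<close>, as provided by (ZP1), thus exhibits a vertex labeled \<open>k\<close>, and so the
  interval of labels is all of the integers.
\<close>

lemma weak_harmonic_ZP1_imp_harmonic:
  assumes weak: "weak_harmonic_labeling V adj l" and no_leaves: "leaves V adj = {}"
    and ZP1: "ZP1 (label_collection V adj l)"
  shows "harmonic_labeling V adj l"
proof -
  have inj: "inj_on l V" and harm: "\<forall>v\<in>V. harmonic_at adj l v"
    using weak no_leaves by (auto simp: weak_harmonic_labeling_def bij_betw_def)
  have "k \<in> l ` V" for k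
  proof -
    obtain v where v: "v \<in> V" and "av (l ` closed_nbrs adj v) = real_of_int k"
      using ZP1 no_leaves unfolding ZP1_def label_collection_def by auto
    then have "l v = k" using av_closed_nbrs_labels[OF v inj] harm by simp
    with v show ?thesis by blast
  qed
  with inj harm show ?thesis by (auto simp: harmonic_labeling_def bij_betw_def)
qed

end

theorem theorem19:
  fixes V :: "'a set" and adj :: "'a \<Rightarrow> 'a \<Rightarrow> bool"
  assumes "bounded_simple_graph V adj"
  shows "((\<exists>l. harmonic_labeling V adj l) \<longleftrightarrow>
            leaves V adj = {} \<and>
            (\<exists>l. weak_harmonic_labeling V adj l \<and>
                 ZP1 (label_collection V adj l) \<and>
                 ZP2 (label_collection V adj l) \<and>
                 ZP3 (label_collection V adj l)))
       \<and> (\<forall>l. weak_harmonic_labeling V adj l \<longrightarrow>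
            (harmonic_labeling V adj l \<longleftrightarrow>
               leaves V adj = {} \<and>
               ZP1 (label_collection V adj l) \<and>
               ZP2 (label_collection V adj l) \<and>
               ZP3 (label_collection V adj l)))"
proof -
  interpret bounded_simple_graph V adj by fact
  show ?thesis
    using harmonic_imp_weak_harmonic harmonic_imp_no_leaves harmonic_imp_ZP
      weak_harmonic_ZP1_imp_harmonic
    by blast
qed

end
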